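(* Let $X$ and $M$ be real Banach spaces, let $\mathcal{U}\subset X$ and $\mathcal{O}\subset M$ be open subsets, let $J:\mathcal{U}\times\mathcal{O}\to\mathbb{R}$ be a real valued functional, and fix $\mu_0\in\mathcal{O}$. Assume: 1. $J(\cdot,\mu)\in C^2(\mathcal{U})$ for every $\mu\in\mathcal{O}$, and $\partial_XJ\in C^0(\mathcal{U}\times\mathcal{O},X')$; 2. $u_0\in\mathcal{U}$ satisfies $\partial_XJ(u_0,\mu_0)=0$; 3. $\partial_X^2J$ is continuous at $(w,\mu)=(u_0,\mu_0)$; 4. there exists $\alpha>0$ such that $\partial_X^2J(u_0,\mu_0)[w,w]\ge\alpha\|w\|_X^2$ for all $w\in X$. Then there exist a convex open neighborhood $\mathcal{U}_0\times\mathcal{O}_0\subset\mathcal{U}\times\mathcal{O}$ of $(u_0,\mu_0)$ and a map $u\in C^0(\mathcal{O}_0,\mathcal{U}_0)$ such that, for every $\mu\in\mathcal{O}_0$, the following three conditions are equivalent: (a) $w\in\mathcal{U}_0$ is a local minimizer of $J(\cdot,\mu)$; (b) $w\in\mathcal{U}_0$ satisfies $\partial_XJ(w,\mu)=0$; (c) $w=u(\mu)$. In this case, $u(\mu)$ is a global minimizer of $J(\cdot,\mu)$ on $\mathcal{U}_0$.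
   Context: $X'$ is the dual space of $X$. $\partial_X$ denotes the partial Fréchet derivative of $J(w,\mu)$ with respect to $w\in X$, and $\partial_X^2J$ the second partial Fréchet derivative, regarded as a bounded bilinear form on $X$. $C^k$ means $k$ times continuously Fréchet differentiable. For a real valued functional $J$ on a metric space $S$, $u_0\in S$ is a global minimizer of $J$ in $S$ if $J(u_0)\le J(u)$ for all $u\in S$; it is a local minimizer if there is an open set $G\subset S$ containing $u_0$ such that $u_0$ is a global minimizer of $J$ in $G$. *)

theory Defs
  imports "HOL-Analysis.Analysis"
begin

text \<open>The derivative as an element of the Banach space of bounded linear maps with the
  operator norm; it is meaningful only where \<open>f\<close> is differentiable.\<close>

definition fderiv ::
  "('a::real_normed_vector \<Rightarrow> 'b::real_normed_vector) \<Rightarrow> 'a \<Rightarrow> ('a \<Rightarrow>\<^sub>L 'b)"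
  where "fderiv f x = Blinfun (frechet_derivative f (at x))"

text \<open>The next two predicates are intended for open sets \<open>S\<close>, since differentiability at a
  point refers to a full neighbourhood of that point.\<close>

definition C1_on ::
  "'a::real_normed_vector set \<Rightarrow> ('a \<Rightarrow> 'b::real_normed_vector) \<Rightarrow> bool"
  where "C1_on S f \<longleftrightarrow> (\<forall>x\<in>S. f differentiable (at x)) \<and> continuous_on S (fderiv f)"

definition C2_on ::
  "'a::real_normed_vector set \<Rightarrow> ('a \<Rightarrow> 'b::real_normed_vector) \<Rightarrow> bool"
  where "C2_on S f \<longleftrightarrow> C1_on S f \<and> C1_on S (fderiv f)"

text \<open>The codomain is polymorphic so that \<open>partial_X (partial_X J)\<close> is the second partial
  derivative. For real-valued \<open>J\<close> its values lie in \<open>'x \<Rightarrow>\<^sub>L ('x \<Rightarrow>\<^sub>L real)\<close>, which is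
  isometrically the space of bounded bilinear forms on \<open>'x\<close>.\<close>

definition partial_X ::
  "('x::real_normed_vector \<times> 'm \<Rightarrow> 'b::real_normed_vector) \<Rightarrow> 'x \<times> 'm \<Rightarrow> ('x \<Rightarrow>\<^sub>L 'b)"
  where "partial_X J p = fderiv (\<lambda>v. J (v, snd p)) (fst p)"

definition global_minimizer :: "'a set \<Rightarrow> ('a \<Rightarrow> real) \<Rightarrow> 'a \<Rightarrow> bool"
  where "global_minimizer S f x \<longleftrightarrow> x \<in> S \<and> (\<forall>y\<in>S. f x \<le> f y)"

definition local_minimizer :: "'a::metric_space set \<Rightarrow> ('a \<Rightarrow> real) \<Rightarrow> 'a \<Rightarrow> bool"
  where "local_minimizer S f x \<longleftrightarrow>
    (\<exists>G. openin (top_of_set S) G \<and> x \<in> G \<and> global_minimizer G f x)"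

end

theory Submission
  imports Defs
begin

text \<open>Near \<open>(u0, \<mu>0)\<close> the second derivative stays coercive, so each \<open>J (\<cdot>, \<mu>)\<close> is strongly convex
  on a ball around \<open>u0\<close>. By the midpoint inequality its minimizing sequences on a smaller closed
  ball are Cauchy, so a minimizer exists, without Lax--Milgram or the implicit function
  theorem. It is interior because \<open>partial_X J (u0, \<mu>)\<close> is small. Strong
  monotonicity of the gradient gives both uniqueness and continuous dependence on \<open>\<mu>\<close>.\<close>

text \<open>\<open>Blinfun\<close> is inverted by \<open>blinfun_apply\<close> only on bounded
  linear maps; differentiability supplies the boundedness.\<close>

lemma has_derivative_fderiv:
  assumes "f differentiable (at x)"
  shows "(f has_derivative blinfun_apply (fderiv f x)) (at x)"
proof -
  have "(f has_derivative frechet_derivative f (at x)) (at x)"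
    using assms frechet_derivative_works by blast
  then show ?thesis
    by (simp add: fderiv_def bounded_linear_Blinfun_apply has_derivative_bounded_linear)
qed

text \<open>Pairing \<open>g\<close> with the fixed direction \<open>y - x\<close> along the segment
  gives a real function whose derivative is the quadratic form of \<open>g'\<close> in that
  direction; the mean value theorem then transfers coercivity to the increment of
  \<open>g\<close>.\<close>

lemma coercive_imp_strongly_monotone:
  fixes g :: "'a::real_normed_vector \<Rightarrow> 'a \<Rightarrow>\<^sub>L real"
  assumes S: "convex S" "x \<in> S" "y \<in> S"
    and g': "\<And>z. z \<in> S \<Longrightarrow> (g has_derivative blinfun_apply (g' z)) (at z)"
    and coercive: "\<And>z h. z \<in> S \<Longrightarrow> c * (norm h)\<^sup>2 \<le> g' z h h"
  shows "c * (norm (y - x))\<^sup>2 \<le> (g y - g x) (y - x)"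
proof -
  let ?h = "y - x"
  let ?p = "\<lambda>t::real. x + t *\<^sub>R ?h"
  have p_in: "?p t \<in> S" if "0 \<le> t" "t \<le> 1" for t
    using convexD_alt[OF S that] by (simp add: algebra_simps)
  have "((\<lambda>t. g (?p t) ?h) has_real_derivative g' (?p t) ?h ?h) (at t)" if "0 \<le> t" "t \<le> 1" for t
  proof -
    have "((\<lambda>t. g (?p t)) has_derivative (\<lambda>s. g' (?p t) (s *\<^sub>R ?h))) (at t)"
      by (rule has_derivative_compose[where f = ?p and f' = "\<lambda>s. s *\<^sub>R ?h", OF _ g'[OF p_in[OF that]]])
        (auto intro!: derivative_eq_intros)
    from bounded_linear.has_derivative[OF bounded_linear_apply_blinfun[of ?h] this]
    show ?thesis
      by (simp add: has_field_derivative_def blinfun.scaleR_left blinfun.scaleR_right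
          mult.commute[of _ "g' (?p t) ?h ?h"])
  qed
  from MVT2[of 0 1 "\<lambda>t. g (?p t) ?h", OF _ this] obtain z where
    z: "0 < z" "z < 1" "g (?p 1) ?h - g (?p 0) ?h = g' (?p z) ?h ?h"
    by auto
  with coercive[OF p_in[of z], of ?h] show ?thesis
    by (simp add: blinfun.diff_left)
qed

text \<open>Strong convexity is obtained from the gradient alone: after the affine and quadratic
  terms are removed, the restriction of \<open>f\<close> to the segment has nonnegative
  slope.\<close>

lemma strongly_monotone_imp_quadratic_lower_bound:
  fixes f :: "'a::real_normed_vector \<Rightarrow> real"
  assumes S: "convex S" "x \<in> S" "y \<in> S"
    and f': "\<And>z. z \<in> S \<Longrightarrow> (f has_derivative blinfun_apply (g z)) (at z)"
    and mono: "\<And>u v. u \<in> S \<Longrightarrow> v \<in> S \<Longrightarrow> c * (norm (v - u))\<^sup>2 \<le> (g v - g u) (v - u)"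
  shows "f x + g x (y - x) + c / 2 * (norm (y - x))\<^sup>2 \<le> f y"
proof -
  let ?h = "y - x"
  let ?p = "\<lambda>t::real. x + t *\<^sub>R ?h"
  \<comment> \<open>Chosen so that the claim reads \<open>?q 0 \<le> ?q 1\<close>; it remains to see
    that \<open>?q'\<close> is nonnegative at the intermediate point.\<close>
  let ?q = "\<lambda>t. f (?p t) - t * g x ?h - c / 2 * t\<^sup>2 * (norm ?h)\<^sup>2"
  let ?q' = "\<lambda>t. g (?p t) ?h - g x ?h - c * t * (norm ?h)\<^sup>2"
  have p_in: "?p t \<in> S" if "0 \<le> t" "t \<le> 1" for t
    using convexD_alt[OF S that] by (simp add: algebra_simps)
  have "(?q has_real_derivative ?q' t) (at t)" if "0 \<le> t" "t \<le> 1" for t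
  proof -
    have "((\<lambda>t. f (?p t)) has_derivative (\<lambda>s. g (?p t) (s *\<^sub>R ?h))) (at t)"
      by (rule has_derivative_compose[where f = ?p and f' = "\<lambda>s. s *\<^sub>R ?h", OF _ f'[OF p_in[OF that]]])
        (auto intro!: derivative_eq_intros)
    then have "((\<lambda>t. f (?p t)) has_real_derivative g (?p t) ?h) (at t)"
      by (simp add: has_field_derivative_def blinfun.scaleR_right mult.commute[of _ "g (?p t) ?h"])
    then show ?thesis
      by (auto intro!: derivative_eq_intros)
  qed
  from MVT2[of 0 1 ?q, OF _ this] obtain z where
    z: "0 < z" "z < 1" "?q 1 - ?q 0 = ?q' z"
    by auto
  \<comment> \<open>Monotonicity between \<open>x\<close> and \<open>?p z\<close>, which differ by
    \<open>z\<close> times \<open>?h\<close>. The left side carries the factor \<open>z\<close>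
    twice and the right side once, so dividing by \<open>z > 0\<close> leaves the bound on the
    slope.\<close>
  have "c * (norm (z *\<^sub>R ?h))\<^sup>2 \<le> (g (?p z) - g x) (z *\<^sub>R ?h)"
    using mono[OF S(2) p_in[of z]] z(1,2) by simp
  then have "z * (c * z * (norm ?h)\<^sup>2) \<le> z * (g (?p z) ?h - g x ?h)"
    by (simp only: blinfun.diff_left blinfun.scaleR_right norm_scaleR power_mult_distrib power2_abs)
      (simp add: power2_eq_square mult_ac)
  then have "c * z * (norm ?h)\<^sup>2 \<le> g (?p z) ?h - g x ?h"
    using z(1) by simp
  with z(3) show ?thesis by simp
qed

text \<open>The midpoint of two nearly optimal points cannot have a value below the infimum, so the
  gain in \<open>mid\<close> forces these points to be close. Completeness thus replaces compactness
  of \<open>K\<close>.\<close>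

lemma midpoint_convex_attains_min:
  fixes f :: "'a::banach \<Rightarrow> real"
  assumes K: "closed K" "convex K" "K \<noteq> {}" and cont: "continuous_on K f"
    and below: "bdd_below (f ` K)" and "c > 0"
    and mid: "\<And>x y. x \<in> K \<Longrightarrow> y \<in> K \<Longrightarrow>
      f (midpoint x y) + c * (norm (x - y))\<^sup>2 \<le> (f x + f y) / 2"
  obtains x where "x \<in> K" "\<And>y. y \<in> K \<Longrightarrow> f x \<le> f y"
proof -
  define m where "m = (INF x\<in>K. f x)"
  have m_le: "m \<le> f x" if "x \<in> K" for x
    unfolding m_def using below that by (rule cINF_lower)
  have "\<exists>x\<in>K. f x < m + inverse (real (Suc n))" for n
    using cInf_lessD[of "f ` K" "m + inverse (real (Suc n))"] K(3) by (auto simp: m_def)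
  then obtain s where s: "\<And>n. s n \<in> K" "\<And>n. f (s n) < m + inverse (real (Suc n))"
    by metis
  \<comment> \<open>Both values lie below \<open>m + inverse (real (Suc n))\<close> while the
    midpoint value is at least \<open>m\<close>.\<close>
  have dist_le: "c * (norm (s i - s j))\<^sup>2 \<le> inverse (real (Suc n))" if "n \<le> i" "n \<le> j" for i j n
  proof -
    have "inverse (real (Suc i)) \<le> inverse (real (Suc n))" "inverse (real (Suc j)) \<le> inverse (real (Suc n))"
      using that by (auto intro!: le_imp_inverse_le)
    moreover have "midpoint (s i) (s j) \<in> K"
      using convexD[OF K(2) s(1) s(1), of "1/2" "1/2" i j]
      by (simp add: midpoint_def scaleR_right_distrib)
    ultimately show ?thesis
      using mid[OF s(1)[of i] s(1)[of j]] s(2)[of i] s(2)[of j] m_le[of "midpoint (s i) (s j)"]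
      by argo
  qed
  have "Cauchy s"
  proof (rule metric_CauchyI)
    fix e :: real assume "0 < e"
    then obtain n where n: "inverse (real (Suc n)) < c * e\<^sup>2"
      using reals_Archimedean[of "c * e\<^sup>2"] \<open>c > 0\<close> by auto
    have "dist (s i) (s j) < e" if "n \<le> i" "n \<le> j" for i j
    proof -
      have "c * (norm (s i - s j))\<^sup>2 < c * e\<^sup>2"
        using dist_le[OF that] n by simp
      then have "(norm (s i - s j))\<^sup>2 < e\<^sup>2" using \<open>c > 0\<close> by simp
      then show ?thesis
        using \<open>0 < e\<close> by (simp add: dist_norm power2_less_imp_less)
    qed
    then show "\<exists>N. \<forall>i\<ge>N. \<forall>j\<ge>N. dist (s i) (s j) < e" by blast
  qed
  then obtain x where x: "s \<longlonglongrightarrow> x"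
    by (auto simp: Cauchy_convergent_iff convergent_def)
  then have "x \<in> K" using K(1) s(1) closed_sequentially by blast
  have "(\<lambda>n. f (s n)) \<longlonglongrightarrow> f x"
    using continuous_on_tendsto_compose[OF cont x \<open>x \<in> K\<close>] s(1) by simp
  moreover have "(\<lambda>n. m + inverse (real (Suc n))) \<longlonglongrightarrow> m + 0"
    by (intro tendsto_intros LIMSEQ_inverse_real_of_nat)
  ultimately have "f x \<le> m + 0"
    by (rule LIMSEQ_le) (use s(2) less_imp_le in blast)
  with m_le \<open>x \<in> K\<close> that show thesis by fastforce
qed

text \<open>The bound on \<open>g a\<close> makes \<open>f\<close> larger on the sphere of radius \<open>r\<close> than at its center.\<close>

lemma strongly_monotone_minimizer_in_ball:
  fixes f :: "'a::banach \<Rightarrow> real"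
  assumes S: "convex S" "cball a r \<subseteq> S" and "r > 0" and "c > 0"
    and f': "\<And>z. z \<in> S \<Longrightarrow> (f has_derivative blinfun_apply (g z)) (at z)"
    and mono: "\<And>u v. u \<in> S \<Longrightarrow> v \<in> S \<Longrightarrow> c * (norm (v - u))\<^sup>2 \<le> (g v - g u) (v - u)"
    and small: "norm (g a) < c / 2 * r"
  obtains x where "x \<in> ball a r" "\<And>y. y \<in> cball a r \<Longrightarrow> f x \<le> f y"
proof -
  have lower: "f x + g x (y - x) + c / 2 * (norm (y - x))\<^sup>2 \<le> f y" if "x \<in> S" "y \<in> S" for x y
    using strongly_monotone_imp_quadratic_lower_bound[OF S(1) that f' mono] .
  have "a \<in> S" using S(2) \<open>r > 0\<close> by auto
  have lower_a: "f a - norm (g a) * norm (y - a) + c / 2 * (norm (y - a))\<^sup>2 \<le> f y"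
    if "y \<in> cball a r" for y
    using lower[of a y] norm_blinfun[of "g a" "y - a"] \<open>a \<in> S\<close> that S(2) by fastforce
  \<comment> \<open>A closed ball need not be compact, so boundedness below comes from the growth
    estimate, with its quadratic term dropped.\<close>
  have "f a - norm (g a) * r \<le> f y" if "y \<in> cball a r" for y
  proof -
    have "norm (g a) * norm (y - a) \<le> norm (g a) * r"
      using that by (intro mult_left_mono) (auto simp: dist_norm norm_minus_commute)
    moreover have "0 \<le> c / 2 * (norm (y - a))\<^sup>2" using \<open>c > 0\<close> by simp
    ultimately show ?thesis using lower_a[OF that] by linarith
  qed
  then have below: "bdd_below (f ` cball a r)" by (auto intro!: bdd_belowI2)
  have cont: "continuous_on (cball a r) f"
    using S(2) f' by (meson continuous_at_imp_continuous_on has_derivative_continuous subsetD)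
  \<comment> \<open>The lower bound is used with the midpoint as base point, towards
    \<open>x\<close> and towards \<open>y\<close>. The two displacements are opposite, so the
    gradient terms cancel; each has half the length of \<open>x - y\<close>, which turns
    \<open>c / 2\<close> into \<open>c / 8\<close>.\<close>
  have mid: "f (midpoint x y) + c / 8 * (norm (x - y))\<^sup>2 \<le> (f x + f y) / 2"
    if xy: "x \<in> cball a r" "y \<in> cball a r" for x y
  proof -
    let ?m = "midpoint x y"
    have S': "x \<in> S" "y \<in> S" using xy S(2) by auto
    then have "?m \<in> S"
      using convexD[OF S(1), of x y "1/2" "1/2"] by (simp add: midpoint_def scaleR_right_distrib)
    have x: "x - ?m = (1/2) *\<^sub>R (x - y)" and y: "y - ?m = - ((1/2) *\<^sub>R (x - y))"
      by (simp_all add: midpoint_def algebra_simps flip: scaleR_left_distrib scaleR_add_left)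
    have "g ?m (x - ?m) + g ?m (y - ?m) = 0"
      unfolding x y by (simp add: blinfun.minus_right)
    moreover have "c / 2 * (norm (x - ?m))\<^sup>2 = c / 8 * (norm (x - y))\<^sup>2"
      "c / 2 * (norm (y - ?m))\<^sup>2 = c / 8 * (norm (x - y))\<^sup>2"
      unfolding x y by (simp_all add: power_divide)
    ultimately show ?thesis
      using lower[OF \<open>?m \<in> S\<close> S'(1)] lower[OF \<open>?m \<in> S\<close> S'(2)] by argo
  qed
  obtain x where x: "x \<in> cball a r" "\<And>y. y \<in> cball a r \<Longrightarrow> f x \<le> f y"
    using midpoint_convex_attains_min[OF closed_cball convex_cball _ cont below _ mid] \<open>r > 0\<close> \<open>c > 0\<close>
    by auto
  have "norm (x - a) \<noteq> r"
  proof
    assume eq: "norm (x - a) = r"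
    have "norm (g a) * r < c / 2 * r * r"
      using small \<open>r > 0\<close> by simp
    then have "f a < f x"
      using lower_a[OF x(1)] unfolding eq power2_eq_square by simp
    then show False using x(2)[of a] \<open>r > 0\<close> by simp
  qed
  with x(1) have "x \<in> ball a r" by (simp add: dist_norm norm_minus_commute)
  with x(2) that show thesis by blast
qed

text \<open>Since \<open>S\<close> is open, a relatively open neighborhood is open in the whole
  space, and the usual first-order condition applies.\<close>

lemma local_minimizer_has_derivative_zero:
  fixes f :: "'a::real_normed_vector \<Rightarrow> real"
  assumes "local_minimizer S f x" "open S" "(f has_derivative blinfun_apply D) (at x)"
  shows "D = 0"
proof -
  obtain G where "open G" "x \<in> G" "\<forall>y\<in>G. f x \<le> f y"
    using assms by (auto simp: local_minimizer_def global_minimizer_def openin_open)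
  then have "blinfun_apply D = (\<lambda>h. 0)"
    using differential_zero_maxmin[OF _ _ assms(3)] by blast
  then show ?thesis by (intro blinfun_eqI) simp
qed

theorem theorem0p2p4:
  fixes J :: "'x::banach \<times> 'm::banach \<Rightarrow> real"
    and \<U> :: "'x set" and \<O> :: "'m set"
    and u0 :: 'x and \<mu>0 :: 'm
  assumes "open \<U>" and "open \<O>" and "\<mu>0 \<in> \<O>"
    and "\<And>\<mu>. \<mu> \<in> \<O> \<Longrightarrow> C2_on \<U> (\<lambda>w. J (w, \<mu>))"
    and "continuous_on (\<U> \<times> \<O>) (partial_X J)"
    and "u0 \<in> \<U>" and "partial_X J (u0, \<mu>0) = 0"
    and "continuous (at (u0, \<mu>0) within \<U> \<times> \<O>) (partial_X (partial_X J))"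
    and "\<exists>\<alpha>>0. \<forall>w. blinfun_apply (blinfun_apply (partial_X (partial_X J) (u0, \<mu>0)) w) w
                    \<ge> \<alpha> * (norm w)\<^sup>2"
  shows "\<exists>\<U>0 \<O>0 u.
      open (\<U>0 \<times> \<O>0) \<and> convex (\<U>0 \<times> \<O>0) \<and> (u0, \<mu>0) \<in> \<U>0 \<times> \<O>0 \<and>
      \<U>0 \<times> \<O>0 \<subseteq> \<U> \<times> \<O> \<and>
      continuous_on \<O>0 u \<and> u ` \<O>0 \<subseteq> \<U>0 \<and>
      (\<forall>\<mu>\<in>\<O>0.
        (\<forall>w. (w \<in> \<U>0 \<and> local_minimizer \<U> (\<lambda>v. J (v, \<mu>)) w
                \<longleftrightarrow> w \<in> \<U>0 \<and> partial_X J (w, \<mu>) = 0) \<and>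
             (w \<in> \<U>0 \<and> partial_X J (w, \<mu>) = 0 \<longleftrightarrow> w = u \<mu>)) \<and>
        global_minimizer \<U>0 (\<lambda>v. J (v, \<mu>)) (u \<mu>))"
proof -
  \<comment> \<open>The parameter comes first so that \<open>g \<mu>\<close> is the gradient field
    of \<open>J\<close> at fixed \<open>\<mu>\<close>, the form in which the lemmas above take
    it.\<close>
  define g where "g \<mu> w = partial_X J (w, \<mu>)" for \<mu> w
  define g' where "g' \<mu> w = partial_X (partial_X J) (w, \<mu>)" for \<mu> w
  have f': "((\<lambda>v. J (v, \<mu>)) has_derivative blinfun_apply (g \<mu> w)) (at w)"
    if "\<mu> \<in> \<O>" "w \<in> \<U>" for \<mu> w
    using assms(4)[OF that(1)] that(2) has_derivative_fderiv
    by (auto simp: C2_on_def C1_on_def g_def partial_X_def)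
  have g': "(g \<mu> has_derivative blinfun_apply (g' \<mu> w)) (at w)"
    if "\<mu> \<in> \<O>" "w \<in> \<U>" for \<mu> w
  proof -
    have eq: "g \<mu> = fderiv (\<lambda>v. J (v, \<mu>))" by (auto simp: g_def partial_X_def)
    have "fderiv (g \<mu>) w = g' \<mu> w" by (simp add: g'_def g_def[abs_def] partial_X_def)
    moreover have "g \<mu> differentiable (at w)"
      using assms(4)[OF that(1)] that(2) unfolding eq by (auto simp: C2_on_def C1_on_def)
    ultimately show ?thesis using has_derivative_fderiv by metis
  qed
  obtain \<alpha> where \<alpha>: "\<alpha> > 0" "\<And>h. \<alpha> * (norm h)\<^sup>2 \<le> g' \<mu>0 u0 h h"
    using assms(9) by (auto simp: g'_def)
  obtain d where d: "d > 0"
    "\<And>w \<mu>. w \<in> \<U> \<Longrightarrow> \<mu> \<in> \<O> \<Longrightarrow> dist (w, \<mu>) (u0, \<mu>0) < d \<Longrightarrow> dist (g' \<mu> w) (g' \<mu>0 u0) < \<alpha> / 2"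
    using assms(8) \<alpha>(1) unfolding continuous_within_eps_delta g'_def
    by (metis half_gt_zero mem_Sigma_iff)
  obtain d1 where d1: "d1 > 0" "ball u0 d1 \<subseteq> \<U>" using assms(1,6) openE by blast
  obtain d2 where d2: "d2 > 0" "ball \<mu>0 d2 \<subseteq> \<O>" using assms(2,3) openE by blast
  \<comment> \<open>The distance \<open>d\<close> is shared equally between the two factors of the
    product; the other half enters \<open>\<sigma>\<close>.\<close>
  define \<rho> where "\<rho> = min d1 (d / 2)"
  define S where "S = ball u0 \<rho>"
  \<comment> \<open>The closed ball of radius \<open>r\<close> must fit into the open ball
    \<open>S\<close>, where derivatives and monotonicity are available.\<close>
  define r where "r = \<rho> / 2"
  \<comment> \<open>What remains of the coercivity constant when the second derivative moves by less
    than \<open>\<alpha> / 2\<close>.\<close>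
  define c where "c = \<alpha> / 2"
  have "c > 0" "r > 0" "r < \<rho>" using \<alpha>(1) d(1) d1(1) by (auto simp: c_def r_def \<rho>_def)
  have S: "convex S" "cball u0 r \<subseteq> S" "S \<subseteq> \<U>"
    using \<open>r < \<rho>\<close> d1(2) by (auto simp: S_def \<rho>_def)
  have "continuous (at (u0, \<mu>0)) (partial_X J)"
    using assms(1,2,3,5,6) by (metis continuous_on_eq_continuous_at mem_Sigma_iff open_Times)
  \<comment> \<open>The threshold \<open>c / 2 * r\<close> is the gradient bound that keeps the
    minimizer off the sphere of radius \<open>r\<close>.\<close>
  then obtain d3 where d3: "d3 > 0"
    "\<And>p. dist p (u0, \<mu>0) < d3 \<Longrightarrow> dist (partial_X J p) (partial_X J (u0, \<mu>0)) < c / 2 * r"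
    unfolding continuous_at_eps_delta using \<open>c > 0\<close> \<open>r > 0\<close> by (metis half_gt_zero mult_pos_pos)
  define \<sigma> where "\<sigma> = min d2 (min (d / 2) d3)"
  let ?O = "ball \<mu>0 \<sigma>"
  have \<sigma>: "\<sigma> > 0" "?O \<subseteq> \<O>" using d(1) d2 d3(1) by (auto simp: \<sigma>_def)
  have coercive: "c * (norm h)\<^sup>2 \<le> g' \<mu> w h h" if "\<mu> \<in> ?O" "w \<in> S" for \<mu> w h
  proof -
    have "dist (w, \<mu>) (u0, \<mu>0) \<le> dist w u0 + dist \<mu> \<mu>0"
      by (simp add: dist_prod_def sqrt_sum_squares_le_sum)
    also have "\<dots> < d"
      using that by (simp add: S_def \<rho>_def \<sigma>_def dist_commute)
    finally have "norm (g' \<mu> w - g' \<mu>0 u0) < c"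
      using d(2)[of w \<mu>] subsetD[OF S(3) that(2)] subsetD[OF \<sigma>(2) that(1)]
      by (simp add: c_def dist_norm)
    moreover have "\<bar>(g' \<mu> w - g' \<mu>0 u0) h h\<bar> \<le> norm (g' \<mu> w - g' \<mu>0 u0) * norm h * norm h"
    proof -
      have "\<bar>(g' \<mu> w - g' \<mu>0 u0) h h\<bar> \<le> norm ((g' \<mu> w - g' \<mu>0 u0) h) * norm h"
        using norm_blinfun[of "(g' \<mu> w - g' \<mu>0 u0) h" h] by simp
      also have "\<dots> \<le> norm (g' \<mu> w - g' \<mu>0 u0) * norm h * norm h"
        by (intro mult_right_mono norm_blinfun norm_ge_zero)
      finally show ?thesis .
    qed
    ultimately have "\<bar>(g' \<mu> w - g' \<mu>0 u0) h h\<bar> \<le> c * (norm h)\<^sup>2"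
      by (smt (verit, best) mult_right_mono norm_ge_zero power2_eq_square mult.assoc zero_le_power2)
    then show ?thesis
      using \<alpha>(2)[of h] unfolding blinfun.diff_left c_def by argo
  qed
  have mono: "c * (norm (v - w))\<^sup>2 \<le> (g \<mu> v - g \<mu> w) (v - w)"
    if "\<mu> \<in> ?O" "w \<in> S" "v \<in> S" for \<mu> w v
    using that \<sigma>(2) S(3)
    by (intro coercive_imp_strongly_monotone[OF S(1), where g' = "g' \<mu>"] g' coercive) auto
  have "\<exists>x. x \<in> ball u0 r \<and> (\<forall>y\<in>ball u0 r. J (x, \<mu>) \<le> J (y, \<mu>))" if \<mu>: "\<mu> \<in> ?O" for \<mu>
  proof -
    have "dist (u0, \<mu>) (u0, \<mu>0) < d3"
      using \<mu> by (simp add: dist_prod_def \<sigma>_def dist_commute)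
    then have "norm (g \<mu> u0) < c / 2 * r"
      using d3(2) assms(7) by (fastforce simp: g_def)
    then obtain x where "x \<in> ball u0 r" "\<And>y. y \<in> cball u0 r \<Longrightarrow> J (x, \<mu>) \<le> J (y, \<mu>)"
      using strongly_monotone_minimizer_in_ball[OF S(1,2) \<open>r > 0\<close> \<open>c > 0\<close> f' mono[OF \<mu>]]
        \<mu> \<sigma>(2) S(3) by (metis subsetD)
    then show ?thesis by auto
  qed
  then obtain u where u: "\<And>\<mu>. \<mu> \<in> ?O \<Longrightarrow> u \<mu> \<in> ball u0 r"
    "\<And>\<mu> y. \<mu> \<in> ?O \<Longrightarrow> y \<in> ball u0 r \<Longrightarrow> J (u \<mu>, \<mu>) \<le> J (y, \<mu>)"
    by metis
  have U0: "ball u0 r \<subseteq> S" "ball u0 r \<subseteq> \<U>" using S(2,3) ball_subset_cball by blast+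
  have u_global: "global_minimizer (ball u0 r) (\<lambda>v. J (v, \<mu>)) (u \<mu>)" if "\<mu> \<in> ?O" for \<mu>
    using u that by (auto simp: global_minimizer_def)
  \<comment> \<open>The open ball itself serves as the relatively open set \<open>G\<close>.\<close>
  then have u_local: "local_minimizer \<U> (\<lambda>v. J (v, \<mu>)) (u \<mu>)" if "\<mu> \<in> ?O" for \<mu>
    using that u(1) U0(2) unfolding local_minimizer_def by (meson open_ball open_subset)
  have local_zero: "g \<mu> w = 0"
    if "\<mu> \<in> ?O" "w \<in> ball u0 r" "local_minimizer \<U> (\<lambda>v. J (v, \<mu>)) w" for \<mu> w
    using local_minimizer_has_derivative_zero[OF that(3) assms(1) f'] that(1,2) \<sigma>(2) U0(2) by blast
  have u_zero: "g \<mu> (u \<mu>) = 0" if "\<mu> \<in> ?O" for \<mu>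
    using local_zero u_local u(1) that by blast
  \<comment> \<open>The gradient at \<open>w\<close> controls the distance to
    \<open>u \<mu>\<close>. A vanishing gradient gives uniqueness; the choice
    \<open>w = u \<nu>\<close> gives continuity.\<close>
  have dist_u: "c * norm (w - u \<mu>) \<le> norm (g \<mu> w)" if "\<mu> \<in> ?O" "w \<in> ball u0 r" for \<mu> w
  proof -
    have "c * (norm (w - u \<mu>))\<^sup>2 \<le> g \<mu> w (w - u \<mu>)"
      using mono[OF that(1) subsetD[OF U0(1) u(1)[OF that(1)]] subsetD[OF U0(1) that(2)]] u_zero[OF that(1)]
      by simp
    also have "\<dots> \<le> norm (g \<mu> w) * norm (w - u \<mu>)"
      using norm_blinfun[of "g \<mu> w" "w - u \<mu>"] by simp
    finally show ?thesis
      by (cases "w = u \<mu>") (simp_all add: power2_eq_square)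
  qed
  have zero_u: "w = u \<mu>" if "\<mu> \<in> ?O" "w \<in> ball u0 r" "g \<mu> w = 0" for \<mu> w
    using dist_u[OF that(1,2)] that(3) \<open>c > 0\<close> by (simp add: mult_le_0_iff)
  have "continuous_on ?O u"
    unfolding continuous_on_def
  proof
    fix \<nu> assume \<nu>: "\<nu> \<in> ?O"
    have "u \<nu> \<in> \<U>" using u(1)[OF \<nu>] U0(2) by blast
    \<comment> \<open>The point \<open>u \<nu>\<close> stays fixed while \<open>\<mu>\<close>
      varies, so continuity of \<open>u\<close> is not presupposed. The gradient vanishes at
      \<open>\<mu> = \<nu>\<close> and hence tends to zero there, and \<open>dist_u\<close> carries
      this over to \<open>u \<mu> - u \<nu>\<close>.\<close>
    then have "continuous_on ?O (\<lambda>\<mu>. partial_X J (u \<nu>, \<mu>))"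
      using \<sigma>(2) by (intro continuous_on_compose2[OF assms(5)] continuous_intros) auto
    then have "((\<lambda>\<mu>. g \<mu> (u \<nu>)) \<longlongrightarrow> g \<nu> (u \<nu>)) (at \<nu> within ?O)"
      using \<nu> by (auto simp: continuous_on_def g_def)
    then have "((\<lambda>\<mu>. norm (g \<mu> (u \<nu>)) / c) \<longlongrightarrow> 0) (at \<nu> within ?O)"
      using \<open>c > 0\<close> unfolding u_zero[OF \<nu>] by (auto intro!: tendsto_eq_intros)
    moreover have "\<forall>\<^sub>F \<mu> in at \<nu> within ?O. norm (u \<mu> - u \<nu>) \<le> norm (g \<mu> (u \<nu>)) / c"
      unfolding eventually_at_filter
      using dist_u[OF _ u(1)[OF \<nu>]] \<open>c > 0\<close>
      by (auto simp: norm_minus_commute field_simps)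
    ultimately show "(u \<longlongrightarrow> u \<nu>) (at \<nu> within ?O)"
      by (rule LIM_zero_cancel[OF Lim_null_comparison, rotated])
  qed
  moreover have "convex (ball u0 r \<times> ?O)" "open (ball u0 r \<times> ?O)"
    by (simp_all add: convex_Times open_Times)
  moreover have "(u0, \<mu>0) \<in> ball u0 r \<times> ?O" "ball u0 r \<times> ?O \<subseteq> \<U> \<times> \<O>"
    using \<open>r > 0\<close> \<sigma> U0(2) by auto
  moreover have "u ` ?O \<subseteq> ball u0 r" using u(1) by blast
  moreover have "\<forall>\<mu>\<in>?O.
      (\<forall>w. (w \<in> ball u0 r \<and> local_minimizer \<U> (\<lambda>v. J (v, \<mu>)) w
            \<longleftrightarrow> w \<in> ball u0 r \<and> partial_X J (w, \<mu>) = 0) \<and>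
          (w \<in> ball u0 r \<and> partial_X J (w, \<mu>) = 0 \<longleftrightarrow> w = u \<mu>)) \<and>
      global_minimizer (ball u0 r) (\<lambda>v. J (v, \<mu>)) (u \<mu>)"
  proof (intro ballI conjI allI)
    fix \<mu> w assume \<mu>: "\<mu> \<in> ?O"
    show "w \<in> ball u0 r \<and> partial_X J (w, \<mu>) = 0 \<longleftrightarrow> w = u \<mu>"
      using zero_u[OF \<mu>] u_zero[OF \<mu>] u(1)[OF \<mu>] unfolding g_def by metis
    then show "w \<in> ball u0 r \<and> local_minimizer \<U> (\<lambda>v. J (v, \<mu>)) w
        \<longleftrightarrow> w \<in> ball u0 r \<and> partial_X J (w, \<mu>) = 0"
      using local_zero[OF \<mu>] u_local[OF \<mu>] unfolding g_def by metis
  qed (rule u_global)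
  ultimately show ?thesis by metis
qed

end
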